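(* Let $ABC$ be a triangle. If a triangle center $X$ is concurrent for an admissible transversal $\ell_0$ of $\triangle ABC$, then $X$ is concurrent for every admissible transversal of $\triangle ABC$ parallel to $\ell_0$.
   Context: An admissible transversal of $\triangle ABC$ is a line $\ell$ that passes through no vertex and is parallel to no side; it meets the sidelines $BC,CA,AB$ at $D,E,F$ respectively. A triangle center $X$ is given by a center function $f(x,y,z)$ of side lengths, homogeneous and symmetric in its last two arguments; for a triangle $P_1P_2P_3$ whose sides opposite $P_1,P_2,P_3$ have lengths $\lambda_1,\lambda_2,\lambda_3$, its $X$-point is the point with homogeneous barycentric coordinates $(f(\lambda_1,\lambda_2,\lambda_3):f(\lambda_2,\lambda_3,\lambda_1):f(\lambda_3,\lambda_1,\lambda_2))$ relative to $P_1P_2P_3$. With $G,H,I$ the $X$-points of triangles $AEF$, $BFD$, $CDE$, the center $X$ is called concurrent for $\ell$ if the lines $AG,BH,CI$ (assumed well defined) are concurrent; three parallel lines count as concurrent. *)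

theory Defs
  imports "HOL-Analysis.Analysis"
begin

type_synonym plane = "real ^ 2"

definition line :: "plane set \<Rightarrow> bool" where
  "line l \<longleftrightarrow> affine l \<and> aff_dim l = 1"

definition nondegenerate_triangle :: "plane \<Rightarrow> plane \<Rightarrow> plane \<Rightarrow> bool" where
  "nondegenerate_triangle A B C \<longleftrightarrow> \<not> collinear {A, B, C}"

definition admissible :: "plane \<Rightarrow> plane \<Rightarrow> plane \<Rightarrow> plane set \<Rightarrow> bool" where
  "admissible A B C l \<longleftrightarrow> line l \<and> A \<notin> l \<and> B \<notin> l \<and> C \<notin> l \<and>
     \<not> affine_parallel l (affine hull {B, C}) \<and>
     \<not> affine_parallel l (affine hull {C, A}) \<and>
     \<not> affine_parallel l (affine hull {A, B})"

definition triangle_sides :: "real \<Rightarrow> real \<Rightarrow> real \<Rightarrow> bool" where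
  "triangle_sides x y z \<longleftrightarrow> x < y + z \<and> y < z + x \<and> z < x + y"

text \<open>
  The value of a center function matters only at side lengths of nondegenerate triangles,
  so its two properties are required only there (the three strict inequalities imply
  that the lengths are positive).  The degree of homogeneity may be any real number.
\<close>

definition center_function :: "(real \<Rightarrow> real \<Rightarrow> real \<Rightarrow> real) \<Rightarrow> bool" where
  "center_function f \<longleftrightarrow>
     (\<exists>n::real. \<forall>t x y z. t > 0 \<and> triangle_sides x y z \<longrightarrow>
        f (t * x) (t * y) (t * z) = t powr n * f x y z) \<and>
     (\<forall>x y z. triangle_sides x y z \<longrightarrow> f x y z = f x z y)"

text \<open>
  Homogeneous barycentric coordinates with sum \<open>0\<close> describe a point at infinity.
  \<open>Ideal v\<close> stands for the point at infinity in the direction of the nonzero vector \<open>v\<close>;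
  \<open>Ideal 0\<close> arises for a nondegenerate reference triangle only from the coordinates
  \<open>(0 : 0 : 0)\<close> and represents no point.
\<close>

datatype ext_point = Proper plane | Ideal plane

definition barycentric_point ::
  "plane \<Rightarrow> plane \<Rightarrow> plane \<Rightarrow> real \<Rightarrow> real \<Rightarrow> real \<Rightarrow> ext_point" where
  "barycentric_point P1 P2 P3 u v w =
     (if u + v + w \<noteq> 0
      then Proper ((1 / (u + v + w)) *\<^sub>R (u *\<^sub>R P1 + v *\<^sub>R P2 + w *\<^sub>R P3))
      else Ideal (u *\<^sub>R P1 + v *\<^sub>R P2 + w *\<^sub>R P3))"

definition center_point ::
  "(real \<Rightarrow> real \<Rightarrow> real \<Rightarrow> real) \<Rightarrow> plane \<Rightarrow> plane \<Rightarrow> plane \<Rightarrow> ext_point" where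
  "center_point f P1 P2 P3 =
     (let l1 = dist P2 P3; l2 = dist P3 P1; l3 = dist P1 P2
      in barycentric_point P1 P2 P3 (f l1 l2 l3) (f l2 l3 l1) (f l3 l1 l2))"

fun join_defined :: "plane \<Rightarrow> ext_point \<Rightarrow> bool" where
  "join_defined A (Proper G) \<longleftrightarrow> G \<noteq> A"
| "join_defined A (Ideal v) \<longleftrightarrow> v \<noteq> 0"

fun join :: "plane \<Rightarrow> ext_point \<Rightarrow> plane set" where
  "join A (Proper G) = affine hull {A, G}"
| "join A (Ideal v) = range (\<lambda>t::real. A + t *\<^sub>R v)"

text \<open>\<open>affine_parallel\<close> is reflexive, so coincident lines count as parallel.\<close>

definition concurrent_lines :: "plane set \<Rightarrow> plane set \<Rightarrow> plane set \<Rightarrow> bool" where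
  "concurrent_lines l m n \<longleftrightarrow>
     (\<exists>P. P \<in> l \<and> P \<in> m \<and> P \<in> n) \<or> (affine_parallel l m \<and> affine_parallel m n)"

definition concurrent_for ::
  "(real \<Rightarrow> real \<Rightarrow> real \<Rightarrow> real) \<Rightarrow> plane \<Rightarrow> plane \<Rightarrow> plane \<Rightarrow> plane set \<Rightarrow> bool" where
  "concurrent_for f A B C l \<longleftrightarrow>
     (\<exists>D E F G H I.
        l \<inter> affine hull {B, C} = {D} \<and>
        l \<inter> affine hull {C, A} = {E} \<and>
        l \<inter> affine hull {A, B} = {F} \<and>
        G = center_point f A E F \<and>
        H = center_point f B F D \<and>
        I = center_point f C D E \<and>
        join_defined A G \<and> join_defined B H \<and> join_defined C I \<and>
        concurrent_lines (join A G) (join B H) (join C I))"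

end

theory Submission
  imports Defs
begin

text \<open>
  The lines \<open>AG\<close>, \<open>BH\<close>, \<open>CI\<close> do not change at all when the transversal is replaced by a parallel
  one, so neither does their concurrence.  Indeed, if \<open>l\<close> is parallel to \<open>l0\<close> and cuts the
  sidelines through \<open>A\<close> in \<open>E'\<close> and \<open>F'\<close>, then the homothety with center \<open>A\<close> that carries \<open>l0\<close> to
  \<open>l\<close> carries \<open>E\<close>, \<open>F\<close> to \<open>E'\<close>, \<open>F'\<close>
  (\<open>parallel_transversal_section\<close>).  It multiplies all side lengths of \<open>AEF\<close> by the absolute value
  of its ratio, so by homogeneity the barycentric coordinates of the \<open>X\<close>-point are multiplied by a
  common positive factor; the \<open>X\<close>-point of \<open>AE'F'\<close> is therefore the image of that of \<open>AEF\<close> and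
  spans the same line with \<open>A\<close> (\<open>center_line_homothety\<close>).  The ratio may be negative, and it is in
  general different for the three vertices.
\<close>

lemma strict_triangle_ineq:
  fixes P Q R :: "'a::euclidean_space"
  assumes "\<not> collinear {P, Q, R}"
  shows "dist P Q < dist P R + dist R Q"
proof -
  have "dist P Q \<noteq> dist P R + dist R Q"
    using assms between_imp_collinear[of P Q R] by (auto simp: between insert_commute)
  then show ?thesis
    using dist_triangle[of P Q R] by linarith
qed

lemma triangle_sides_dist:
  assumes "\<not> collinear {P, Q, R :: plane}"
  shows "triangle_sides (dist Q R) (dist R P) (dist P Q)"
  using strict_triangle_ineq[of P Q R] strict_triangle_ineq[of Q R P] strict_triangle_ineq[of R P Q]
    assms
  unfolding triangle_sides_def by (simp add: insert_commute dist_commute)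

lemma dist_homothety:
  fixes A E F :: "'a::real_normed_vector"
  shows "dist (A + k *\<^sub>R (E - A)) (A + k *\<^sub>R (F - A)) = \<bar>k\<bar> * dist E F"
proof -
  have "A + k *\<^sub>R (E - A) - (A + k *\<^sub>R (F - A)) = k *\<^sub>R (E - F)"
    by (simp add: algebra_simps)
  then show ?thesis
    by (simp add: dist_norm)
qed

lemma range_line_scaleR:
  fixes A v :: "'a::real_vector"
  assumes "k \<noteq> 0"
  shows "range (\<lambda>t::real. A + t *\<^sub>R (k *\<^sub>R v)) = range (\<lambda>t. A + t *\<^sub>R v)"
proof -
  have "A + t *\<^sub>R v = A + (t / k) *\<^sub>R (k *\<^sub>R v)" for t
    using assms by simp
  moreover have "A + t *\<^sub>R (k *\<^sub>R v) = A + (t * k) *\<^sub>R v" for t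
    by simp
  ultimately show ?thesis
    by (metis (mono_tags, lifting) rangeI image_subsetI subset_antisym)
qed

lemma join_Proper: "join A (Proper G) = range (\<lambda>t. A + t *\<^sub>R (G - A))"
  by (simp add: affine_hull_2_alt)

text \<open>With \<open>W = v (E - A) + w (F - A)\<close>, the line joining \<open>A\<close> to the point \<open>(u : v : w)\<close> of \<open>AEF\<close>
  has direction \<open>W\<close>, whether that point is proper or ideal; the homothety only rescales \<open>W\<close>.\<close>

lemma barycentric_line_homothety:
  fixes A E F :: plane and k s u v w :: real
  assumes k: "k \<noteq> 0" and s: "s \<noteq> 0"
  defines "G \<equiv> barycentric_point A E F u v w"
    and "G' \<equiv> barycentric_point A (A + k *\<^sub>R (E - A)) (A + k *\<^sub>R (F - A)) (s * u) (s * v) (s * w)"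
  shows "join A G' = join A G" and "join_defined A G' \<longleftrightarrow> join_defined A G"
proof -
  define S where "S = u + v + w"
  define W where "W = v *\<^sub>R (E - A) + w *\<^sub>R (F - A)"
  have sum: "s * u + s * v + s * w = s * S"
    by (simp add: S_def algebra_simps)
  have comb: "u *\<^sub>R A + v *\<^sub>R E + w *\<^sub>R F = S *\<^sub>R A + W"
    by (simp add: S_def W_def algebra_simps)
  have comb': "(s * u) *\<^sub>R A + (s * v) *\<^sub>R (A + k *\<^sub>R (E - A)) + (s * w) *\<^sub>R (A + k *\<^sub>R (F - A))
      = (s * S) *\<^sub>R A + (s * k) *\<^sub>R W"
    by (simp add: S_def W_def algebra_simps)
  have "join A G' = join A G \<and> (join_defined A G' \<longleftrightarrow> join_defined A G)"
  proof (cases "S = 0")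
    case True
    then have "G = Ideal W" "G' = Ideal ((s * k) *\<^sub>R W)"
      unfolding G_def G'_def barycentric_point_def sum comb comb' by (simp_all add: S_def)
    then show ?thesis
      using k s range_line_scaleR[of "s * k" A W] by simp
  next
    case False
    define V where "V = (1 / S) *\<^sub>R W"
    have "G = Proper (A + V)"
      using False unfolding G_def barycentric_point_def comb V_def
      by (simp add: S_def[symmetric] scaleR_add_right)
    moreover have "G' = Proper (A + k *\<^sub>R V)"
      using False s unfolding G'_def barycentric_point_def sum comb' V_def
      by (simp add: scaleR_add_right)
    ultimately show ?thesis
      using k range_line_scaleR[of k A V] by (simp add: join_Proper del: join.simps(1))
  qed
  then show "join A G' = join A G" and "join_defined A G' \<longleftrightarrow> join_defined A G"
    by auto
qed

text \<open>The triangle \<open>AEF\<close> must be nondegenerate because a center function is homogeneous only at the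
  side lengths of such triangles.\<close>

lemma center_line_homothety:
  fixes A E F :: plane and k :: real
  assumes f: "center_function f" and nd: "\<not> collinear {A, E, F}" and k: "k \<noteq> 0"
  defines "G \<equiv> center_point f A E F"
    and "G' \<equiv> center_point f A (A + k *\<^sub>R (E - A)) (A + k *\<^sub>R (F - A))"
  shows "join A G' = join A G" and "join_defined A G' \<longleftrightarrow> join_defined A G"
proof -
  obtain n where hom: "\<And>t x y z. t > 0 \<Longrightarrow> triangle_sides x y z \<Longrightarrow>
      f (t * x) (t * y) (t * z) = t powr n * f x y z"
    using f unfolding center_function_def by blast
  define a b c where "a = dist E F" and "b = dist F A" and "c = dist A E"
  have "triangle_sides a b c"
    unfolding a_def b_def c_def using triangle_sides_dist[OF nd] .
  then have sides: "triangle_sides a b c" "triangle_sides b c a" "triangle_sides c a b"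
    by (auto simp: triangle_sides_def)
  have G: "G = barycentric_point A E F (f a b c) (f b c a) (f c a b)"
    by (simp add: G_def center_point_def Let_def a_def b_def c_def)
  have "dist (A + k *\<^sub>R (E - A)) (A + k *\<^sub>R (F - A)) = \<bar>k\<bar> * a"
    "dist (A + k *\<^sub>R (F - A)) A = \<bar>k\<bar> * b" "dist A (A + k *\<^sub>R (E - A)) = \<bar>k\<bar> * c"
    using dist_homothety[of A k E F] dist_homothety[of A k F A] dist_homothety[of A k A E]
    by (simp_all add: a_def b_def c_def)
  then have G': "G' = barycentric_point A (A + k *\<^sub>R (E - A)) (A + k *\<^sub>R (F - A))
      (\<bar>k\<bar> powr n * f a b c) (\<bar>k\<bar> powr n * f b c a) (\<bar>k\<bar> powr n * f c a b)"
    using k sides by (simp add: G'_def center_point_def Let_def hom)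
  have "\<bar>k\<bar> powr n \<noteq> 0"
    using k by simp
  then show "join A G' = join A G" and "join_defined A G' \<longleftrightarrow> join_defined A G"
    unfolding G G' using barycentric_line_homothety[OF k] by blast+
qed

text \<open>The ratio of the homothety with center \<open>P\<close> depends only on \<open>P\<close> and the two parallel lines, not
  on the line \<open>PQ\<close>.\<close>

lemma parallel_transversal_section:
  fixes P Q X m :: "'a::euclidean_space"
  assumes X: "{x. m \<bullet> x = c} \<inter> affine hull {P, Q} = {X}" and P: "m \<bullet> P \<noteq> c"
  shows "{x. m \<bullet> x = c'} \<inter> affine hull {P, Q} =
    {P + ((c' - m \<bullet> P) / (c - m \<bullet> P)) *\<^sub>R (X - P)}"
proof -
  have "X \<in> affine hull {P, Q}" and mX: "m \<bullet> X = c"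
    using X by auto
  then obtain t where t: "X = P + t *\<^sub>R (Q - P)"
    by (auto simp: affine_hull_2_alt)
  have mt: "t * (m \<bullet> (Q - P)) = c - m \<bullet> P"
    using mX by (simp add: t inner_add_right)
  then have nz: "m \<bullet> (Q - P) \<noteq> 0" "t \<noteq> 0"
    using P by auto
  have on: "m \<bullet> (P + r *\<^sub>R (Q - P)) = c' \<longleftrightarrow> r = (c' - m \<bullet> P) / (m \<bullet> (Q - P))" for r
    using nz by (auto simp: inner_add_right eq_divide_eq)
  have "{x. m \<bullet> x = c'} \<inter> affine hull {P, Q} =
      {P + ((c' - m \<bullet> P) / (m \<bullet> (Q - P))) *\<^sub>R (Q - P)}"
  proof (rule set_eqI)
    fix x
    have "x \<in> {x. m \<bullet> x = c'} \<inter> affine hull {P, Q} \<longleftrightarrow>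
        (\<exists>r. x = P + r *\<^sub>R (Q - P) \<and> m \<bullet> (P + r *\<^sub>R (Q - P)) = c')"
      by (auto simp: affine_hull_2_alt)
    then show "x \<in> {x. m \<bullet> x = c'} \<inter> affine hull {P, Q} \<longleftrightarrow>
        x \<in> {P + ((c' - m \<bullet> P) / (m \<bullet> (Q - P))) *\<^sub>R (Q - P)}"
      unfolding on by simp
  qed
  moreover have "(c' - m \<bullet> P) / (m \<bullet> (Q - P)) = (c' - m \<bullet> P) / (c - m \<bullet> P) * t"
    using nz by (simp flip: mt)
  ultimately show ?thesis
    by (simp add: t)
qed

lemma not_collinear_points_on_sides:
  fixes P Q R X Y :: "'a::real_vector"
  assumes nd: "\<not> collinear {P, Q, R}"
    and X: "X \<in> affine hull {P, Q}" "X \<noteq> P" and Y: "Y \<in> affine hull {P, R}" "Y \<noteq> P"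
  shows "\<not> collinear {P, X, Y}"
proof
  assume "collinear {P, X, Y}"
  obtain s where s: "X = P + s *\<^sub>R (Q - P)" "s \<noteq> 0"
    using X by (auto simp: affine_hull_2_alt)
  obtain t where t: "Y = P + t *\<^sub>R (R - P)" "t \<noteq> 0"
    using Y by (auto simp: affine_hull_2_alt)
  have "Q \<in> affine hull {P, X}"
  proof -
    have "Q = P + (1 / s) *\<^sub>R (X - P)" using s by simp
    then show ?thesis unfolding affine_hull_2_alt by blast
  qed
  moreover have "R \<in> affine hull {P, Y}"
  proof -
    have "R = P + (1 / t) *\<^sub>R (Y - P)" using t by simp
    then show ?thesis unfolding affine_hull_2_alt by blast
  qed
  ultimately have "{P, Q, R} \<subseteq> affine hull {P, X, Y}"
    using hull_mono[of "{P, X}" "{P, X, Y}" affine] hull_mono[of "{P, Y}" "{P, X, Y}" affine]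
      hull_inc[of P "{P, X, Y}" affine] by auto
  then show False
    using nd \<open>collinear {P, X, Y}\<close> collinear_affine_hull_collinear collinear_subset by blast
qed

lemma center_line_parallel_transversal:
  assumes f: "center_function f" and nd: "\<not> collinear {P, Q, R}"
    and P: "m \<bullet> P \<noteq> c" "m \<bullet> P \<noteq> c'"
    and X: "{x. m \<bullet> x = c} \<inter> affine hull {P, Q} = {X}"
    and Y: "{x. m \<bullet> x = c} \<inter> affine hull {P, R} = {Y}"
    and X': "{x. m \<bullet> x = c'} \<inter> affine hull {P, Q} = {X'}"
    and Y': "{x. m \<bullet> x = c'} \<inter> affine hull {P, R} = {Y'}"
  shows "join P (center_point f P X' Y') = join P (center_point f P X Y)"
    and "join_defined P (center_point f P X' Y') \<longleftrightarrow> join_defined P (center_point f P X Y)"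
proof -
  define k where "k = (c' - m \<bullet> P) / (c - m \<bullet> P)"
  have k: "k \<noteq> 0"
    using P by (simp add: k_def)
  have X'_eq: "X' = P + k *\<^sub>R (X - P)"
    using parallel_transversal_section[OF X P(1), of c'] X' by (simp add: k_def)
  have Y'_eq: "Y' = P + k *\<^sub>R (Y - P)"
    using parallel_transversal_section[OF Y P(1), of c'] Y' by (simp add: k_def)
  have "X \<in> affine hull {P, Q}" "X \<noteq> P" "Y \<in> affine hull {P, R}" "Y \<noteq> P"
    using X Y P by auto
  then have "\<not> collinear {P, X, Y}"
    using not_collinear_points_on_sides[OF nd] by blast
  then show "join P (center_point f P X' Y') = join P (center_point f P X Y)"
    and "join_defined P (center_point f P X' Y') \<longleftrightarrow> join_defined P (center_point f P X Y)"
    unfolding X'_eq Y'_eq using center_line_homothety[OF f _ k] by blast+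
qed

lemma line_eq_hyperplane:
  assumes "line l"
  obtains m c where "l = {x. m \<bullet> x = c}"
proof -
  have "aff_dim l = int (DIM(plane) - 1)"
    using assms by (simp add: line_def)
  then obtain m c where "affine hull l = {x. m \<bullet> x = c}"
    using aff_dim_eq_hyperplane by metis
  then show thesis
    using that assms by (simp add: line_def hull_same)
qed

theorem theorem9p2:
  fixes A B C :: plane
    and f :: "real \<Rightarrow> real \<Rightarrow> real \<Rightarrow> real"
    and l0 l :: "plane set"
  assumes "nondegenerate_triangle A B C"
    and "center_function f"
    and "admissible A B C l0"
    and "concurrent_for f A B C l0"
    and "admissible A B C l"
    and "affine_parallel l0 l"
  shows "concurrent_for f A B C l"
proof -
  have nd: "\<not> collinear {A, C, B}" "\<not> collinear {B, A, C}" "\<not> collinear {C, B, A}"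
    using assms(1) by (simp_all add: nondegenerate_triangle_def insert_commute)
  obtain m c where l0: "l0 = {x. m \<bullet> x = c}"
    using assms(3) line_eq_hyperplane unfolding admissible_def by blast
  obtain a where "l = (+) a ` l0"
    using assms(6) unfolding affine_parallel_def by blast
  define c' where "c' = c + m \<bullet> a"
  have "x \<in> l \<longleftrightarrow> m \<bullet> x = c'" for x
  proof -
    have "x \<in> l \<longleftrightarrow> x - a \<in> l0"
      unfolding \<open>l = (+) a ` l0\<close> by (force simp: image_iff)
    then show ?thesis
      by (auto simp: l0 c'_def inner_diff_right)
  qed
  then have l: "l = {x. m \<bullet> x = c'}"
    by auto
  have off: "m \<bullet> A \<noteq> c" "m \<bullet> B \<noteq> c" "m \<bullet> C \<noteq> c" "m \<bullet> A \<noteq> c'" "m \<bullet> B \<noteq> c'" "m \<bullet> C \<noteq> c'"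
    using assms(3,5) by (auto simp: admissible_def l0 l)
  obtain D E F where
    D: "l0 \<inter> affine hull {B, C} = {D}" and
    E: "l0 \<inter> affine hull {C, A} = {E}" and
    F: "l0 \<inter> affine hull {A, B} = {F}" and
    joins: "join_defined A (center_point f A E F)" "join_defined B (center_point f B F D)"
      "join_defined C (center_point f C D E)" and
    conc: "concurrent_lines (join A (center_point f A E F)) (join B (center_point f B F D))
      (join C (center_point f C D E))"
    using assms(4) unfolding concurrent_for_def by blast
  obtain D' where D': "l \<inter> affine hull {B, C} = {D'}"
    using parallel_transversal_section[OF D[unfolded l0] off(2), of c'] unfolding l by blast
  obtain E' where E': "l \<inter> affine hull {C, A} = {E'}"
    using parallel_transversal_section[OF E[unfolded l0] off(3), of c'] unfolding l by blast
  obtain F' where F': "l \<inter> affine hull {A, B} = {F'}"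
    using parallel_transversal_section[OF F[unfolded l0] off(1), of c'] unfolding l by blast
  note swap = insert_commute[of B C "{}"] insert_commute[of C A "{}"] insert_commute[of A B "{}"]
  note atA = center_line_parallel_transversal[OF assms(2) nd(1) off(1,4)
      E[unfolded l0 swap] F[unfolded l0] E'[unfolded l swap] F'[unfolded l]]
  note atB = center_line_parallel_transversal[OF assms(2) nd(2) off(2,5)
      F[unfolded l0 swap] D[unfolded l0] F'[unfolded l swap] D'[unfolded l]]
  note atC = center_line_parallel_transversal[OF assms(2) nd(3) off(3,6)
      D[unfolded l0 swap] E[unfolded l0] D'[unfolded l swap] E'[unfolded l]]
  show ?thesis
    unfolding concurrent_for_def
    using D' E' F' joins conc atA atB atC by metis
qed

end
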